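(* Let $L$ be an extension of a field $K$ of finite transcendence degree, and suppose $L$ is complete Galois over $K$. Then there is a one-to-one correspondence between finite subgroups $H$ of $Aut(L/K)$ and intermediate fields $K\subseteq M\subseteq L$ with $[L:M]<+\infty$, given by $H=Aut(L/M)$ and $M=L^H$.
   Context: $Aut(L/K)$ is the group of automorphisms of $L$ fixing $K$ pointwise; $L^H$ is the fixed field of $H$. $L$ is Galois over $M$ if $L^{Aut(L/M)}=M$; $L$ is complete Galois over $K$ if $L$ is Galois over every intermediate field $M$, $K\subseteq M\subseteq L$. *)

theory Defs
  imports "HOL-Algebra.Algebra"
begin

text \<open>Elements are extensional, i.e. \<^term>\<open>undefined\<close> outside \<^term>\<open>carrier L\<close>, as for
  \<^const>\<open>Bij\<close>: otherwise one automorphism of \<open>L\<close> would be represented by many HOL functions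
  and finiteness of sets of automorphisms would be meaningless.\<close>

definition field_auto :: "('a, 'b) ring_scheme \<Rightarrow> 'a set \<Rightarrow> ('a \<Rightarrow> 'a) set"
  where "field_auto L K = {\<sigma> \<in> ring_hom L L \<inter> Bij (carrier L). \<forall>x\<in>K. \<sigma> x = x}"

definition FieldAutoGroup :: "('a, 'b) ring_scheme \<Rightarrow> 'a set \<Rightarrow> ('a \<Rightarrow> 'a) monoid"
  where "FieldAutoGroup L K = BijGroup (carrier L) \<lparr>carrier := field_auto L K\<rparr>"

definition fixed_field :: "('a, 'b) ring_scheme \<Rightarrow> ('a \<Rightarrow> 'a) set \<Rightarrow> 'a set"
  where "fixed_field L H = {x \<in> carrier L. \<forall>\<sigma>\<in>H. \<sigma> x = x}"

definition intermediate_field :: "('a, 'b) ring_scheme \<Rightarrow> 'a set \<Rightarrow> 'a set \<Rightarrow> bool"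
  where "intermediate_field L K M \<longleftrightarrow> subfield M L \<and> K \<subseteq> M"

definition galois_over :: "('a, 'b) ring_scheme \<Rightarrow> 'a set \<Rightarrow> bool"
  where "galois_over L M \<longleftrightarrow> fixed_field L (field_auto L M) = M"

definition complete_galois_over :: "('a, 'b) ring_scheme \<Rightarrow> 'a set \<Rightarrow> bool"
  where "complete_galois_over L K \<longleftrightarrow> (\<forall>M. intermediate_field L K M \<longrightarrow> galois_over L M)"

text \<open>The value of a polynomial whose variables are indexed by ring elements, each variable being
  substituted by its own index. Members of \<^const>\<open>ring.indexed_pset\<close> have finite support, so the
  sum below is a genuine finite sum for them.\<close>

definition (in ring) indexed_value :: "('a multiset \<Rightarrow> 'a) \<Rightarrow> 'a"
  where "indexed_value P =
    (\<Oplus>m\<in>{m. P m \<noteq> \<zero>}. P m \<otimes> (\<Otimes>x\<in>set_mset m. x [^] count m x))"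

definition (in ring) algebraically_independent :: "'a set \<Rightarrow> 'a set \<Rightarrow> bool"
  where "algebraically_independent K B \<longleftrightarrow>
    B \<subseteq> carrier R \<and> (\<forall>P \<in> K[\<X>\<^bsub>B\<^esub>]. indexed_value P = \<zero> \<longrightarrow> P = indexed_const \<zero>)"

definition (in ring) transcendence_basis :: "'a set \<Rightarrow> 'a set \<Rightarrow> bool"
  where "transcendence_basis K B \<longleftrightarrow>
    algebraically_independent K B \<and>
    (\<forall>x \<in> carrier R. (algebraic over (generate_field R (K \<union> B))) x)"

definition (in ring) finite_transcendence_degree :: "'a set \<Rightarrow> bool"
  where "finite_transcendence_degree K \<longleftrightarrow> (\<exists>B. finite B \<and> transcendence_basis K B)"

lemma (in ring) subgroup_field_auto:
  assumes "K \<subseteq> carrier R"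
  shows "subgroup (field_auto R K) (BijGroup (carrier R))"
proof (rule group.subgroupI[OF group_BijGroup])
  show "field_auto R K \<subseteq> carrier (BijGroup (carrier R))"
    by (auto simp: field_auto_def BijGroup_def)
  have "(\<lambda>x\<in>carrier R. x) \<in> field_auto R K"
    using assms by (auto simp: field_auto_def id_Bij ring_hom_def)
  then show "field_auto R K \<noteq> {}" by blast
next
  fix f assume f: "f \<in> field_auto R K"
  then have B: "f \<in> Bij (carrier R)" and h: "f \<in> ring_hom R R" and K: "\<And>x. x \<in> K \<Longrightarrow> f x = x"
    by (auto simp: field_auto_def)
  from B have bij: "bij_betw f (carrier R) (carrier R)" by (simp add: Bij_def)
  let ?g = "\<lambda>x\<in>carrier R. inv_into (carrier R) f x"
  have "?g \<in> ring_hom R R"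
  proof (rule ring_hom_memI)
    fix x y assume "x \<in> carrier R" "y \<in> carrier R"
    then show "?g (x \<otimes> y) = ?g x \<otimes> ?g y" "?g (x \<oplus> y) = ?g x \<oplus> ?g y"
      using Bij_inv_into_lemma[OF _ B, of "(\<otimes>)" x y] Bij_inv_into_lemma[OF _ B, of "(\<oplus>)" x y] h
      by (auto simp: ring_hom_mult ring_hom_add)
  next
    show "?g \<one> = \<one>"
      using bij ring_hom_one[OF h] by (metis bij_betw_inv_into_left one_closed restrict_apply')
  qed (use B in \<open>auto simp: Bij_inv_into_mem\<close>)
  moreover have "?g x = x" if "x \<in> K" for x
    using that K assms bij by (metis bij_betw_inv_into_left restrict_apply' subsetD)
  ultimately show "inv\<^bsub>BijGroup (carrier R)\<^esub> f \<in> field_auto R K"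
    using B by (simp add: inv_BijGroup field_auto_def restrict_inv_into_Bij del: restrict_apply)
next
  fix f g assume "f \<in> field_auto R K" "g \<in> field_auto R K"
  then show "f \<otimes>\<^bsub>BijGroup (carrier R)\<^esub> g \<in> field_auto R K"
    using assms
    by (auto simp: field_auto_def BijGroup_def compose_Bij compose_def subset_iff
        ring_hom_closed ring_hom_mult ring_hom_add ring_hom_one intro!: ring_hom_memI
        dest: compose_Bij)
qed

lemma (in ring) group_FieldAutoGroup:
  assumes "K \<subseteq> carrier R"
  shows "group (FieldAutoGroup R K)"
  unfolding FieldAutoGroup_def
  by (rule subgroup.subgroup_is_group[OF subgroup_field_auto[OF assms] group_BijGroup])

end

theory Submission
  imports Defs
begin

text \<open>
  The hypothesis says that every intermediate field is the fixed field of its automorphism group, so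
  what remains is Artin's theorem: for a finite group \<open>H\<close> of automorphisms with fixed field \<open>F\<close>,
  \<open>card H \<le> card (Aut (L/F)) \<le> [L:F] \<le> card H\<close>. For the middle inequality, if there were more
  automorphisms than elements of a basis of \<open>L\<close> over \<open>F\<close>, the homogeneous system expressing that a
  combination of the automorphisms vanishes on the basis would have a nontrivial solution,
  contradicting Dedekind's independence of characters. For the last one, more than \<open>card H\<close>
  elements \<open>u\<close> of \<open>L\<close> admit coefficients \<open>c u\<close> in \<open>L\<close>, not all zero, with
  \<open>\<Sum>\<^sub>u f u * c u = 0\<close> for all \<open>f \<in> H\<close>; rescaling by some \<open>l\<close> and applying the trace of \<open>H\<close>, which is
  nonzero by independence again, turns them into the coefficients of a linear relation over \<open>F\<close>
  between the \<open>u\<close>.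
\<close>

section \<open>Finite sums and homogeneous linear systems\<close>

lemma (in abelian_monoid) finsum_swap:
  assumes "finite A" "finite B" "\<And>i j. \<lbrakk> i \<in> A; j \<in> B \<rbrakk> \<Longrightarrow> f i j \<in> carrier G"
  shows "(\<Oplus>i\<in>A. \<Oplus>j\<in>B. f i j) = (\<Oplus>j\<in>B. \<Oplus>i\<in>A. f i j)"
  using assms(1,3)
proof (induction A rule: finite_induct)
  case empty
  then show ?case by simp
next
  case (insert a A)
  have "(\<Oplus>i\<in>insert a A. \<Oplus>j\<in>B. f i j) = (\<Oplus>j\<in>B. f a j) \<oplus> (\<Oplus>j\<in>B. \<Oplus>i\<in>A. f i j)"
    using insert by (simp add: Pi_def)
  also have "\<dots> = (\<Oplus>j\<in>B. f a j \<oplus> (\<Oplus>i\<in>A. f i j))"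
    using insert by (subst finsum_addf) (auto simp: Pi_def)
  also have "\<dots> = (\<Oplus>j\<in>B. \<Oplus>i\<in>insert a A. f i j)"
    using insert by (intro finsum_cong') (auto simp: Pi_def)
  finally show ?case .
qed

lemma (in field) underdetermined_homogeneous_system:
  assumes "finite I" "finite J" "card I < card J"
    and "\<And>i j. \<lbrakk> i \<in> I; j \<in> J \<rbrakk> \<Longrightarrow> a i j \<in> carrier R"
  shows "\<exists>c \<in> J \<rightarrow> carrier R. (\<exists>j\<in>J. c j \<noteq> \<zero>) \<and> (\<forall>i\<in>I. (\<Oplus>j\<in>J. a i j \<otimes> c j) = \<zero>)"
  using assms
proof (induction I arbitrary: J a rule: finite_induct)
  case empty
  then have "J \<noteq> {}" by auto
  \<comment> \<open>Without equations every assignment is a solution, so the constant one serves as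
    a nonzero one.\<close>
  then show ?case by (intro bexI[of _ "\<lambda>_. \<one>"]) auto
next
  case (insert i0 I)
  show ?case
  proof (cases "\<forall>j\<in>J. a i0 j = \<zero>")
    case True
    obtain c where c: "c \<in> J \<rightarrow> carrier R" "\<exists>j\<in>J. c j \<noteq> \<zero>" "\<forall>i\<in>I. (\<Oplus>j\<in>J. a i j \<otimes> c j) = \<zero>"
      using insert.IH[of J a] insert.prems insert.hyps by auto
    have "(\<Oplus>j\<in>J. a i0 j \<otimes> c j) = \<zero>"
      using True c(1) by (intro add.finprod_one_eqI) (auto dest: funcset_mem)
    with c show ?thesis by auto
  next
    case False
    then obtain j0 where j0: "j0 \<in> J" "a i0 j0 \<noteq> \<zero>" by blast
    define J' where "J' = J - {j0}"
    have J: "J = insert j0 J'" "j0 \<notin> J'" "finite J'"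
      using j0 insert.prems by (auto simp: J'_def)
    have aJ: "a i j \<in> carrier R" "a i j0 \<in> carrier R" if "i \<in> insert i0 I" "j \<in> J'" for i j
      using insert.prems(3) that J(1) by auto
    have ai: "a i j0 \<in> carrier R" if "i \<in> insert i0 I" for i
      using insert.prems(3) that j0 by auto
    define p where "p = inv (a i0 j0)"
    have p: "p \<in> carrier R" "a i0 j0 \<otimes> p = \<one>"
      using j0 ai[of i0] by (auto simp: p_def field_Units)
    \<comment> \<open>These are the coefficients left after subtracting
      \<open>a i j0 \<otimes> p\<close> times row \<open>i0\<close> from row \<open>i\<close>; since
      \<open>p\<close> inverts the pivot, column \<open>j0\<close> becomes zero.\<close>
    obtain c where c: "c \<in> J' \<rightarrow> carrier R" "\<exists>j\<in>J'. c j \<noteq> \<zero>"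
      "\<forall>i\<in>I. (\<Oplus>j\<in>J'. (a i j \<ominus> a i j0 \<otimes> p \<otimes> a i0 j) \<otimes> c j) = \<zero>"
    proof -
      have "card I < card J'"
        using insert.prems insert.hyps J by auto
      then have "\<exists>c \<in> J' \<rightarrow> carrier R. (\<exists>j\<in>J'. c j \<noteq> \<zero>) \<and>
        (\<forall>i\<in>I. (\<Oplus>j\<in>J'. (a i j \<ominus> a i j0 \<otimes> p \<otimes> a i0 j) \<otimes> c j) = \<zero>)"
        by (intro insert.IH J(3) minus_closed m_closed) (use aJ p(1) in auto)
      then show thesis
        using that by blast
    qed
    have cJ: "c j \<in> carrier R" if "j \<in> J'" for j
      using that c(1) by auto
    define s where "s = (\<Oplus>j\<in>J'. a i0 j \<otimes> c j)"
    have s: "s \<in> carrier R"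
      using aJ cJ by (auto simp: s_def intro!: finsum_closed)
    \<comment> \<open>Equation \<open>i0\<close> forces the value at the pivot:
      \<open>a i0 j0 \<otimes> d j0\<close> must cancel \<open>s\<close>.\<close>
    define d where "d = c(j0 := \<ominus> (p \<otimes> s))"
    have d_sum: "(\<Oplus>j\<in>J. a i j \<otimes> d j) = \<ominus> (a i j0 \<otimes> p \<otimes> s) \<oplus> (\<Oplus>j\<in>J'. a i j \<otimes> c j)"
      if i: "i \<in> insert i0 I" for i
    proof -
      have "(\<Oplus>j\<in>J. a i j \<otimes> d j) = a i j0 \<otimes> d j0 \<oplus> (\<Oplus>j\<in>J'. a i j \<otimes> d j)"
        unfolding J(1) using J i s p ai[OF i] aJ cJ
        by (intro finsum_insert) (auto simp: d_def)
      also have "(\<Oplus>j\<in>J'. a i j \<otimes> d j) = (\<Oplus>j\<in>J'. a i j \<otimes> c j)"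
        using J(2) i aJ cJ by (intro finsum_cong') (auto simp: d_def)
      also have "a i j0 \<otimes> d j0 = \<ominus> (a i j0 \<otimes> p \<otimes> s)"
        using ai[OF i] s p by (simp add: d_def r_minus m_assoc)
      finally show ?thesis .
    qed
    have "(\<Oplus>j\<in>J. a i j \<otimes> d j) = \<zero>" if i: "i \<in> I" for i
    proof -
      \<comment> \<open>Undoing the elimination: the reduced row contributes zero, so only the
        multiple of row \<open>i0\<close> survives, and the pivot term cancels it.\<close>
      have "(\<Oplus>j\<in>J'. a i j \<otimes> c j) =
        (\<Oplus>j\<in>J'. (a i j \<ominus> a i j0 \<otimes> p \<otimes> a i0 j) \<otimes> c j \<oplus> a i j0 \<otimes> p \<otimes> (a i0 j \<otimes> c j))"
      proof (intro finsum_cong' refl)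
        fix j assume j: "j \<in> J'"
        have "a i j \<in> carrier R" "a i j0 \<in> carrier R" "a i0 j \<in> carrier R"
          using aJ ai i j by auto
        with cJ[OF j] p(1)
        show "a i j \<otimes> c j =
          (a i j \<ominus> a i j0 \<otimes> p \<otimes> a i0 j) \<otimes> c j \<oplus> a i j0 \<otimes> p \<otimes> (a i0 j \<otimes> c j)"
          by algebra
      qed (use i aJ cJ p(1) in auto)
      also have "\<dots> = (\<Oplus>j\<in>J'. (a i j \<ominus> a i j0 \<otimes> p \<otimes> a i0 j) \<otimes> c j)
          \<oplus> (\<Oplus>j\<in>J'. a i j0 \<otimes> p \<otimes> (a i0 j \<otimes> c j))"
        using i aJ cJ p(1) by (intro finsum_addf) auto
      also have "\<dots> = a i j0 \<otimes> p \<otimes> s"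
        unfolding s_def using c(3) i aJ ai cJ p(1) J(3)
        by (subst finsum_rdistr) (auto intro!: finsum_closed)
      finally show ?thesis
        using d_sum[of i] i s p(1) ai[of i] by (simp add: l_neg)
    qed
    moreover have "(\<Oplus>j\<in>J. a i0 j \<otimes> d j) = \<zero>"
      using d_sum[of i0] s p by (simp add: l_neg flip: s_def)
    moreover have "d \<in> J \<rightarrow> carrier R"
      using J cJ s p by (auto simp: d_def)
    moreover have "\<exists>j\<in>J. d j \<noteq> \<zero>"
      using c(2) J by (auto simp: d_def)
    ultimately show ?thesis by blast
  qed
qed

section \<open>Dedekind's independence of characters\<close>

text \<open>Induction on the number of homomorphisms: multiplicativity allows a relation to be
  twisted so that one of them drops out. Extensionality ensures that distinct members of
  \<open>S\<close> differ at a point of the carrier.\<close>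

lemma (in domain) ring_homs_linearly_independent:
  assumes "ring A" "finite S" "S \<subseteq> ring_hom A R \<inter> extensional (carrier A)"
    and "c \<in> S \<rightarrow> carrier R"
    and "\<And>x. x \<in> carrier A \<Longrightarrow> (\<Oplus>h\<in>S. c h \<otimes> h x) = \<zero>"
    and "h \<in> S"
  shows "c h = \<zero>"
  using assms(2-)
proof (induction S arbitrary: c h rule: finite_induct)
  case empty
  then show ?case by simp
next
  case (insert g S)
  have shift: "r \<otimes> (s \<otimes> t) = r \<otimes> (s \<ominus> v) \<otimes> t \<oplus> v \<otimes> (r \<otimes> t)"
    if "r \<in> carrier R" "s \<in> carrier R" "t \<in> carrier R" "v \<in> carrier R" for r s t v
    using that by algebra
  have regroup: "r \<otimes> (s \<otimes> t) \<oplus> (v \<oplus> s \<otimes> w) = v \<oplus> s \<otimes> (r \<otimes> t \<oplus> w)"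
    if "r \<in> carrier R" "s \<in> carrier R" "t \<in> carrier R" "v \<in> carrier R" "w \<in> carrier R"
    for r s t v w
    using that by algebra
  interpret A: ring A by fact
  have hom: "f \<in> ring_hom A R" "f \<in> extensional (carrier A)" if "f \<in> insert g S" for f
    using insert.prems(1) that by auto
  have cl: "f x \<in> carrier R" if "f \<in> insert g S" "x \<in> carrier A" for f x
    using ring_hom_closed[OF hom(1)] that by blast
  have cc: "c f \<in> carrier R" if "f \<in> insert g S" for f
    using insert.prems(2) that by auto
  have sum_cl: "(\<Oplus>f\<in>S. c f \<otimes> f x) \<in> carrier R" if "x \<in> carrier A" for x
    using cl cc that by (auto intro!: finsum_closed)
  have split: "c g \<otimes> g x \<oplus> (\<Oplus>f\<in>S. c f \<otimes> f x) = \<zero>" if "x \<in> carrier A" for x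
    using insert.prems(3)[OF that] insert.hyps cl cc that by (simp add: Pi_def)
  have twisted: "(\<Oplus>f\<in>S. c f \<otimes> (f y \<ominus> g y) \<otimes> f x) = \<zero>"
    if x: "x \<in> carrier A" and y: "y \<in> carrier A" for x y
  proof -
    let ?D = "\<Oplus>f\<in>S. c f \<otimes> (f y \<ominus> g y) \<otimes> f x"
    have D: "?D \<in> carrier R"
      using cl cc x y by (auto intro!: finsum_closed)
    have "(\<Oplus>f\<in>S. c f \<otimes> f (y \<otimes>\<^bsub>A\<^esub> x)) =
      (\<Oplus>f\<in>S. c f \<otimes> (f y \<ominus> g y) \<otimes> f x \<oplus> g y \<otimes> (c f \<otimes> f x))"
    proof (intro finsum_cong' refl)
      fix f assume f: "f \<in> S"
      have "f (y \<otimes>\<^bsub>A\<^esub> x) = f y \<otimes> f x"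
        using ring_hom_mult[OF hom(1)] f x y by auto
      then show "c f \<otimes> f (y \<otimes>\<^bsub>A\<^esub> x) = c f \<otimes> (f y \<ominus> g y) \<otimes> f x \<oplus> g y \<otimes> (c f \<otimes> f x)"
        using shift[of "c f" "f y" "f x" "g y"] cl[of f x] cl[of f y] cl[of g y] cc[of f] x y f by simp
    qed (use x y cl cc in auto)
    also have "\<dots> = ?D \<oplus> (\<Oplus>f\<in>S. g y \<otimes> (c f \<otimes> f x))"
      using cl cc x y by (intro finsum_addf) auto
    also have "(\<Oplus>f\<in>S. g y \<otimes> (c f \<otimes> f x)) = g y \<otimes> (\<Oplus>f\<in>S. c f \<otimes> f x)"
      using cl cc x y insert.hyps by (intro finsum_rdistr[symmetric]) auto
    finally have "c g \<otimes> (g y \<otimes> g x) \<oplus> (?D \<oplus> g y \<otimes> (\<Oplus>f\<in>S. c f \<otimes> f x)) = \<zero>"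
      using split[of "y \<otimes>\<^bsub>A\<^esub> x"] ring_hom_mult[OF hom(1)[of g]] x y by simp
    moreover have "c g \<otimes> (g y \<otimes> g x) \<oplus> (?D \<oplus> g y \<otimes> (\<Oplus>f\<in>S. c f \<otimes> f x)) =
      ?D \<oplus> g y \<otimes> (c g \<otimes> g x \<oplus> (\<Oplus>f\<in>S. c f \<otimes> f x))"
      using cl[of g x] cl[of g y] cc[of g] D sum_cl[OF x] x y by (intro regroup) auto
    ultimately show ?thesis
      using split[OF x] D cl[of g y] y by simp
  qed
  have S_zero: "c f = \<zero>" if f: "f \<in> S" for f
  proof -
    have "f \<noteq> g"
      using f insert.hyps by auto
    \<comment> \<open>A point separating \<open>f\<close> from \<open>g\<close> makes the factor
      \<open>f y \<ominus> g y\<close> nonzero, so the vanishing of the twisted coefficient passes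
      to \<open>c f\<close>.\<close>
    then obtain y where y: "y \<in> carrier A" "f y \<noteq> g y"
      using hom(2)[of f] hom(2)[of g] f by (meson extensionalityI insertCI)
    have "c f \<otimes> (f y \<ominus> g y) = \<zero>"
      using insert.IH[of "\<lambda>f. c f \<otimes> (f y \<ominus> g y)" f] twisted[OF _ y(1)] insert.prems(1) f cl cc y(1)
      by auto
    then show ?thesis
      using integral[of "c f" "f y \<ominus> g y"] cc cl y f by auto
  qed
  \<comment> \<open>Only the term of \<open>g\<close> is left in the original relation; at one it
    equals \<open>c g\<close>.\<close>
  have "(\<Oplus>f\<in>S. c f \<otimes> f \<one>\<^bsub>A\<^esub>) = \<zero>"
    using S_zero cl by (intro add.finprod_one_eqI) auto
  then have "c g = \<zero>"
    using split[of "\<one>\<^bsub>A\<^esub>"] ring_hom_one[OF hom(1)[of g]] cc[of g] by simp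
  with S_zero insert.prems(4) show ?case by auto
qed


section \<open>Counting automorphisms against a spanning list\<close>

lemma (in cring) ring_endo_finsum:
  assumes "h \<in> ring_hom R R" "f \<in> A \<rightarrow> carrier R"
  shows "h (\<Oplus>i\<in>A. f i) = (\<Oplus>i\<in>A. h (f i))"
  using ring_hom_cring.hom_finsum[OF ring_hom_cring.intro[OF is_cring is_cring] assms(2)] assms(1)
  by (simp add: ring_hom_cring_axioms_def comp_def)

text \<open>Links linear combinations along lists with sums over sets, where sums can be exchanged.
  Distinctness prevents a repeated entry from being counted once on one side and several times on
  the other.\<close>

lemma (in ring) combine_map_eq_finsum:
  assumes "distinct Us" "set Us \<subseteq> carrier R" "k \<in> set Us \<rightarrow> carrier R"
  shows "combine (map k Us) Us = (\<Oplus>u\<in>set Us. k u \<otimes> u)"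
  using assms by (induction Us) (auto simp: Pi_def subset_iff)

lemma field_autoD:
  assumes "f \<in> field_auto L K"
  shows "f \<in> ring_hom L L" "f \<in> extensional (carrier L)" "bij_betw f (carrier L) (carrier L)"
    and "\<And>x. x \<in> K \<Longrightarrow> f x = x"
  using assms by (auto simp: field_auto_def Bij_def)

text \<open>Finiteness is part of the claim, so the bound is proved for every finite set
  \<open>S\<close> of automorphisms. Too large an \<open>S\<close> would carry a relation that holds
  on \<open>Us\<close>, hence by linearity over \<open>M\<close> everywhere, against
  independence.\<close>

lemma (in field) card_field_auto_le_length_spanning:
  assumes M: "subfield M R" and Us: "set Us \<subseteq> carrier R" "Span M Us = carrier R"
  shows "finite (field_auto R M) \<and> card (field_auto R M) \<le> length Us"
proof (rule finite_if_finite_subsets_card_bdd)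
  fix S assume S: "S \<subseteq> field_auto R M" "finite S"
  have hom: "f \<in> ring_hom R R" if "f \<in> S" for f
    using field_autoD(1) S(1) that by blast
  have fix_M: "f x = x" if "f \<in> S" "x \<in> M" for f x
    using field_autoD(4)[of f R M x] S(1) that by auto
  have cl: "f x \<in> carrier R" if "f \<in> S" "x \<in> carrier R" for f x
    using ring_hom_closed[OF hom] that by blast
  show "card S \<le> length Us"
  proof (rule ccontr)
    assume "\<not> card S \<le> length Us"
    then have "card (set Us) < card S"
      using card_length[of Us] by linarith
    \<comment> \<open>The automorphisms index the unknowns and the spanning elements index the
      equations.\<close>
    then obtain c where c: "c \<in> S \<rightarrow> carrier R" "\<exists>f\<in>S. c f \<noteq> \<zero>"
      "\<forall>u\<in>set Us. (\<Oplus>f\<in>S. f u \<otimes> c f) = \<zero>"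
      using underdetermined_homogeneous_system[of "set Us" S "\<lambda>u f. f u"] S(2) cl Us(1) by blast
    have cc: "c f \<in> carrier R" if "f \<in> S" for f
      using c(1) that by auto
    \<comment> \<open>The kernel of an additive map. To contain the whole span, it need only be an
      additive subgroup containing the \<open>M\<close>-multiples of the entries of
      \<open>Us\<close>.\<close>
    define E where "E = {x \<in> carrier R. (\<Oplus>f\<in>S. c f \<otimes> f x) = \<zero>}"
    have "subgroup E (add_monoid R)"
    proof (rule add.subgroupI)
      show "E \<subseteq> carrier R" by (auto simp: E_def)
      have "(\<Oplus>f\<in>S. c f \<otimes> f \<zero>) = \<zero>"
        using cc by (intro add.finprod_one_eqI) (simp add: ring_hom_zero[OF hom ring_axioms ring_axioms])
      then show "E \<noteq> {}" by (auto simp: E_def)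
    next
      fix x y assume x: "x \<in> E" and y: "y \<in> E"
      have "(\<Oplus>f\<in>S. c f \<otimes> f (x \<oplus> y)) = (\<Oplus>f\<in>S. c f \<otimes> f x \<oplus> c f \<otimes> f y)"
        using x y cc cl
        by (intro finsum_cong') (auto simp: E_def r_distr ring_hom_add[OF hom])
      also have "\<dots> = (\<Oplus>f\<in>S. c f \<otimes> f x) \<oplus> (\<Oplus>f\<in>S. c f \<otimes> f y)"
        using x y cc cl by (intro finsum_addf) (auto simp: E_def)
      finally show "x \<oplus> y \<in> E"
        using x y by (auto simp: E_def)
    next
      fix x assume x: "x \<in> E"
      have "(\<Oplus>f\<in>S. c f \<otimes> f (\<ominus> x)) = (\<Oplus>f\<in>S. \<ominus> \<one> \<otimes> (c f \<otimes> f x))"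
      proof (intro finsum_cong' refl)
        fix f assume f: "f \<in> S"
        interpret ring_hom_ring R R f
          using hom[OF f] by (intro ring_hom_ringI2 ring_axioms)
        show "c f \<otimes> f (\<ominus> x) = \<ominus> \<one> \<otimes> (c f \<otimes> f x)"
          using x f cc cl by (auto simp: E_def r_minus l_minus)
      qed (use x cc cl in \<open>auto simp: E_def\<close>)
      also have "\<dots> = \<ominus> \<one> \<otimes> (\<Oplus>f\<in>S. c f \<otimes> f x)"
        using x cc cl S(2) by (intro finsum_rdistr[symmetric]) (auto simp: E_def)
      finally show "\<ominus> x \<in> E"
        using x by (auto simp: E_def)
    qed
    moreover have "M <#> set Us \<subseteq> E"
    proof
      fix x assume "x \<in> M <#> set Us"
      then obtain m u where x: "x = m \<otimes> u" "m \<in> M" "u \<in> set Us"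
        by (auto simp: set_mult_def)
      have mu: "m \<in> carrier R" "u \<in> carrier R"
        using x subfieldE(3)[OF M] Us(1) by auto
      \<comment> \<open>Every \<open>f\<close> fixes \<open>m\<close>, so \<open>m\<close> is a
        common factor of all summands.\<close>
      have "(\<Oplus>f\<in>S. c f \<otimes> f x) = (\<Oplus>f\<in>S. m \<otimes> (f u \<otimes> c f))"
        using x mu cc cl
        by (intro finsum_cong') (auto simp: m_ac ring_hom_mult[OF hom] fix_M)
      also have "\<dots> = m \<otimes> (\<Oplus>f\<in>S. f u \<otimes> c f)"
        using mu cc cl S(2) by (intro finsum_rdistr[symmetric]) auto
      finally show "x \<in> E"
        using x mu c(3) by (simp add: E_def)
    qed
    ultimately have "carrier R \<subseteq> E"
      using Span_min[OF M Us(1)] Us(2) by blast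
    then have "(\<Oplus>f\<in>S. c f \<otimes> f x) = \<zero>" if "x \<in> carrier R" for x
      using that by (auto simp: E_def)
    moreover have "S \<subseteq> ring_hom R R \<inter> extensional (carrier R)"
      using S(1) field_autoD by blast
    ultimately show False
      using ring_homs_linearly_independent[OF ring_axioms S(2)] c(1,2) by blast
  qed
qed

section \<open>Fixed fields and traces of automorphism groups\<close>

lemma (in field) subfield_fixed_field:
  assumes "H \<subseteq> field_auto R K"
  shows "subfield (fixed_field R H) R"
proof -
  have hom: "ring_hom_ring R R f" if "f \<in> H" for f
    using field_autoD(1) assms that by (intro ring_hom_ringI2 ring_axioms) blast
  have minus: "f (\<ominus> x) = \<ominus> f x" if f: "f \<in> H" and x: "x \<in> carrier R" for f x
  proof -
    interpret f: ring_hom_ring R R f by (rule hom[OF f])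
    show ?thesis using x by simp
  qed
  show ?thesis
  proof (intro subfieldI' subringI)
    fix k assume k: "k \<in> fixed_field R H - {\<zero>}"
    then have k': "k \<in> carrier R" "inv k \<in> carrier R" "k \<otimes> inv k = \<one>"
      by (auto simp: fixed_field_def field_Units)
    have "f (inv k) = inv k" if f: "f \<in> H" for f
    proof -
      interpret f: ring_hom_ring R R f by (rule hom[OF f])
      \<comment> \<open>Since \<open>f\<close> fixes \<open>k\<close>, this exhibits
        \<open>f (inv k)\<close> as an inverse of \<open>k\<close>; uniqueness of inverses does the
        rest.\<close>
      have "k \<otimes> f (inv k) = f (k \<otimes> inv k)"
        using k k' f by (subst f.hom_mult) (auto simp: fixed_field_def)
      also have "\<dots> = \<one>"
        using k' by simp
      finally show ?thesis
        using k' comm_inv_char f.hom_closed by metis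
    qed
    then show "inv k \<in> fixed_field R H"
      using k' by (simp add: fixed_field_def)
  next
    fix h1 h2 assume h: "h1 \<in> fixed_field R H" "h2 \<in> fixed_field R H"
    then have cl: "h1 \<in> carrier R" "h2 \<in> carrier R"
      by (auto simp: fixed_field_def)
    have "f (\<ominus> h1) = \<ominus> h1 \<and> f (h1 \<otimes> h2) = h1 \<otimes> h2 \<and> f (h1 \<oplus> h2) = h1 \<oplus> h2" if f: "f \<in> H" for f
    proof -
      have "f h1 = h1" "f h2 = h2"
        using h f by (auto simp: fixed_field_def)
      then show ?thesis
        using minus[OF f cl(1)] ring_hom_mult[OF ring_hom_ring.homh[OF hom[OF f]] cl]
          ring_hom_add[OF ring_hom_ring.homh[OF hom[OF f]] cl] by simp
    qed
    then show "\<ominus> h1 \<in> fixed_field R H" "h1 \<otimes> h2 \<in> fixed_field R H" "h1 \<oplus> h2 \<in> fixed_field R H"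
      using cl by (auto simp: fixed_field_def)
  qed (auto simp: fixed_field_def ring_hom_one[OF ring_hom_ring.homh[OF hom]])
qed

text \<open>Replaces the group structure by plain facts about functions. Inverses appear as
  pointwise right inverses, the form needed to write an element \<open>u\<close> as
  \<open>f (g u)\<close>.\<close>

lemma (in ring) subgroup_FieldAutoGroupD:
  assumes H: "subgroup H (FieldAutoGroup R K)" and K: "K \<subseteq> carrier R"
  shows "H \<subseteq> field_auto R K"
    and "(\<lambda>x\<in>carrier R. x) \<in> H"
    and "\<And>f g. \<lbrakk> f \<in> H; g \<in> H \<rbrakk> \<Longrightarrow> compose (carrier R) f g \<in> H"
    and "\<And>f. f \<in> H \<Longrightarrow> \<exists>g\<in>H. \<forall>x\<in>carrier R. f (g x) = x"
proof -
  interpret G: group "FieldAutoGroup R K"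
    by (rule group_FieldAutoGroup[OF K])
  show sub: "H \<subseteq> field_auto R K"
    using subgroup.subset[OF H] by (simp add: FieldAutoGroup_def)
  then have Bij: "f \<in> Bij (carrier R)" if "f \<in> H" for f
    using that by (auto simp: field_auto_def)
  show "(\<lambda>x\<in>carrier R. x) \<in> H"
    using subgroup.one_closed[OF H] by (simp add: FieldAutoGroup_def BijGroup_def)
  have mult: "f \<otimes>\<^bsub>FieldAutoGroup R K\<^esub> g = compose (carrier R) f g" if "f \<in> H" "g \<in> H" for f g
    using Bij that by (simp add: FieldAutoGroup_def BijGroup_def)
  show "compose (carrier R) f g \<in> H" if "f \<in> H" "g \<in> H" for f g
    using subgroup.m_closed[OF H that] mult[OF that] by simp
  show "\<exists>g\<in>H. \<forall>x\<in>carrier R. f (g x) = x" if f: "f \<in> H" for f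
  proof (intro bexI ballI)
    let ?g = "inv\<^bsub>FieldAutoGroup R K\<^esub> f"
    show g: "?g \<in> H"
      by (rule subgroup.m_inv_closed[OF H f])
    fix x assume x: "x \<in> carrier R"
    have "compose (carrier R) f ?g = (\<lambda>x\<in>carrier R. x)"
      using G.r_inv[of f] mult[OF f g] subgroup.mem_carrier[OF H f]
      by (simp add: FieldAutoGroup_def BijGroup_def)
    then show "f (?g x) = x"
      using x by (metis compose_eq restrict_apply')
  qed
qed

text \<open>Composing with a member \<open>g\<close> of \<open>H\<close> permutes \<open>H\<close>:
  the map is injective because \<open>g\<close> is, and surjective because \<open>H\<close> is
  finite. Hence \<open>g\<close> merely reorders the summands.\<close>

lemma (in field) trace_in_fixed_field:
  assumes H: "subgroup H (FieldAutoGroup R K)" "finite H" and K: "K \<subseteq> carrier R"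
    and y: "y \<in> carrier R"
  shows "(\<Oplus>f\<in>H. f y) \<in> fixed_field R H"
proof -
  note HD = subgroup_FieldAutoGroupD[OF H(1) K]
  have hom: "f \<in> ring_hom R R" if "f \<in> H" for f
    using HD(1) field_autoD(1) that by blast
  have cl: "f x \<in> carrier R" if "f \<in> H" "x \<in> carrier R" for f x
    using ring_hom_closed[OF hom] that by blast
  have "g (\<Oplus>f\<in>H. f y) = (\<Oplus>f\<in>H. f y)" if g: "g \<in> H" for g
  proof -
    let ?t = "compose (carrier R) g"
    have inj: "inj_on ?t H"
    proof (rule inj_onI)
      fix f f' assume f: "f \<in> H" "f' \<in> H" and eq: "?t f = ?t f'"
      have "f x = f' x" if x: "x \<in> carrier R" for x
      proof (rule inj_onD[of g "carrier R"])
        show "inj_on g (carrier R)"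
          using field_autoD(3) HD(1) g by (blast dest: bij_betw_imp_inj_on)
        show "g (f x) = g (f' x)"
          using eq x by (metis compose_eq)
      qed (use cl f x in auto)
      then show "f = f'"
        using HD(1) field_autoD(2) f by (blast intro: extensionalityI)
    qed
    have surj: "?t ` H = H"
      using inj HD(3)[OF g] H(2) by (intro endo_inj_surj) auto
    have "g (\<Oplus>f\<in>H. f y) = (\<Oplus>f\<in>H. g (f y))"
      using cl y by (intro ring_endo_finsum hom g) auto
    also have "\<dots> = (\<Oplus>f\<in>H. ?t f y)"
      using cl y g by (intro finsum_cong') (auto simp: compose_eq)
    also have "\<dots> = (\<Oplus>f\<in>?t ` H. f y)"
      using inj surj cl y by (intro finsum_reindex[symmetric]) auto
    finally show ?thesis
      using surj by simp
  qed
  then show ?thesis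
    using cl y by (auto simp: fixed_field_def intro!: finsum_closed)
qed

section \<open>The degree over the fixed field\<close>

lemma (in field) independent_over_fixed_field_length_le:
  assumes H: "subgroup H (FieldAutoGroup R K)" "finite H" and K: "K \<subseteq> carrier R"
    and Us: "independent (fixed_field R H) Us"
  shows "length Us \<le> card H"
proof (rule ccontr)
  assume contr: "\<not> length Us \<le> card H"
  note HD = subgroup_FieldAutoGroupD[OF H(1) K]
  have hom: "f \<in> ring_hom R R" if "f \<in> H" for f
    using HD(1) field_autoD(1) that by blast
  have cl: "f x \<in> carrier R" if "f \<in> H" "x \<in> carrier R" for f x
    using ring_hom_closed[OF hom] that by blast
  note F = subfield_fixed_field[OF HD(1)]
  have distinct: "distinct Us"
    by (rule independent_distinct[OF F Us])
  have Us_cl: "u \<in> carrier R" if "u \<in> set Us" for u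
    using independent_in_carrier[OF Us] that by auto
  have "card H < card (set Us)"
    using contr distinct_card[OF distinct] by simp
  then obtain c u0 where c: "c \<in> set Us \<rightarrow> carrier R" "u0 \<in> set Us" "c u0 \<noteq> \<zero>"
    "\<forall>f\<in>H. (\<Oplus>u\<in>set Us. f u \<otimes> c u) = \<zero>"
    using underdetermined_homogeneous_system[of H "set Us" "\<lambda>f u. f u"] H(2) cl Us_cl by blast
  have cc: "c u \<in> carrier R" if "u \<in> set Us" for u
    using c(1) that by auto
  \<comment> \<open>If all traces vanished, the relation with every coefficient one would contradict
    independence; \<open>H\<close> is nonempty as it contains the identity.\<close>
  obtain x where x: "x \<in> carrier R" "(\<Oplus>f\<in>H. f x) \<noteq> \<zero>"
  proof (rule ccontr)
    assume "\<not> thesis"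
    then have zero: "(\<Oplus>f\<in>H. f x) = \<zero>" if "x \<in> carrier R" for x
      using that \<open>\<And>x. x \<in> carrier R \<Longrightarrow> (\<Oplus>f\<in>H. f x) \<noteq> \<zero> \<Longrightarrow> thesis\<close> by blast
    have "(\<Oplus>f\<in>H. \<one> \<otimes> f x) = \<zero>" if "x \<in> carrier R" for x
      using zero[OF that] cl that by (simp cong: finsum_cong add: Pi_def simp_implies_def)
    moreover have "H \<subseteq> ring_hom R R \<inter> extensional (carrier R)"
      using HD(1) field_autoD by blast
    ultimately have "\<one> = \<zero>"
      using ring_homs_linearly_independent[OF ring_axioms H(2), of "\<lambda>_. \<one>"] HD(2) by blast
    then show False by simp
  qed
  \<comment> \<open>The scaling moves the nonzero coefficient \<open>c u0\<close> to
    \<open>x\<close>, so that the trace at \<open>u0\<close> is nonzero.\<close>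
  define l where "l = x \<otimes> inv (c u0)"
  have l: "l \<in> carrier R" "l \<otimes> c u0 = x"
    using x(1) cc[OF c(2)] c(3) by (auto simp: l_def field_Units m_assoc)
  define m where "m u = (\<Oplus>f\<in>H. f (l \<otimes> c u))" for u
  have m: "m u \<in> fixed_field R H" if "u \<in> set Us" for u
    unfolding m_def using l cc[OF that] by (intro trace_in_fixed_field[OF H K]) auto
  have m_cl: "m u \<in> carrier R" if "u \<in> set Us" for u
    using m[OF that] by (auto simp: fixed_field_def)
  have "combine (map m Us) Us = (\<Oplus>u\<in>set Us. m u \<otimes> u)"
    using distinct Us_cl m_cl by (intro combine_map_eq_finsum) auto
  also have "\<dots> = (\<Oplus>u\<in>set Us. \<Oplus>f\<in>H. f (l \<otimes> c u) \<otimes> u)"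
    using Us_cl cl cc l H(2) unfolding m_def
    by (intro finsum_cong' finsum_ldistr) (auto intro!: finsum_closed)
  \<comment> \<open>After the exchange the inner sum vanishes for each \<open>f\<close>
    separately.\<close>
  also have "\<dots> = (\<Oplus>f\<in>H. \<Oplus>u\<in>set Us. f (l \<otimes> c u) \<otimes> u)"
    using Us_cl cl cc l H(2) by (intro finsum_swap) auto
  also have "\<dots> = \<zero>"
  proof (rule add.finprod_one_eqI)
    fix f assume f: "f \<in> H"
    \<comment> \<open>Writing \<open>u\<close> as \<open>f (g u)\<close> pulls \<open>f\<close> out
      of the sum; what remains inside is \<open>l\<close> times the equation of the system belonging
      to \<open>g\<close>, which is zero.\<close>
    obtain g where g: "g \<in> H" "\<forall>x\<in>carrier R. f (g x) = x"
      using HD(4)[OF f] by blast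
    have "(\<Oplus>u\<in>set Us. f (l \<otimes> c u) \<otimes> u) = (\<Oplus>u\<in>set Us. f (l \<otimes> (g u \<otimes> c u)))"
    proof (intro finsum_cong' refl)
      fix u assume u: "u \<in> set Us"
      have "f (l \<otimes> (g u \<otimes> c u)) = f (l \<otimes> c u \<otimes> g u)"
        using l(1) cc[OF u] cl[OF g(1) Us_cl[OF u]] by (simp add: m_ac)
      also have "\<dots> = f (l \<otimes> c u) \<otimes> f (g u)"
        using l(1) cc[OF u] cl[OF g(1) Us_cl[OF u]] by (intro ring_hom_mult[OF hom[OF f]]) auto
      finally show "f (l \<otimes> c u) \<otimes> u = f (l \<otimes> (g u \<otimes> c u))"
        using g(2) Us_cl[OF u] by simp
    qed (use f g(1) cl cc Us_cl l(1) in auto)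
    also have "\<dots> = f (\<Oplus>u\<in>set Us. l \<otimes> (g u \<otimes> c u))"
      using f g(1) cl cc Us_cl l(1) by (intro ring_endo_finsum[OF hom[OF f], symmetric]) auto
    also have "(\<Oplus>u\<in>set Us. l \<otimes> (g u \<otimes> c u)) = l \<otimes> (\<Oplus>u\<in>set Us. g u \<otimes> c u)"
      using g(1) cl cc Us_cl l(1) by (intro finsum_rdistr[symmetric]) auto
    also have "f \<dots> = \<zero>"
      using c(4) g(1) l(1) ring_hom_zero[OF hom[OF f] ring_axioms ring_axioms] by simp
    finally show "(\<Oplus>u\<in>set Us. f (l \<otimes> c u) \<otimes> u) = \<zero>" .
  qed
  finally have "set (take (length Us) (map m Us)) \<subseteq> {\<zero>}"
    using m by (intro independent_imp_trivial_combine[OF F Us]) auto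
  then have "m u0 = \<zero>"
    using c(2) by auto
  then show False
    using x(2) l(2) by (simp add: m_def)
qed

text \<open>An independent list of maximal length spans. The maximum exists because the lengths are
  bounded by \<open>card H\<close> and the empty list is independent.\<close>

lemma (in field) exists_basis_over_fixed_field:
  assumes H: "subgroup H (FieldAutoGroup R K)" "finite H" and K: "K \<subseteq> carrier R"
  obtains Us where "independent (fixed_field R H) Us" "length Us \<le> card H"
    "Span (fixed_field R H) Us = carrier R"
proof -
  let ?F = "fixed_field R H"
  let ?P = "\<lambda>n. \<exists>Us. independent ?F Us \<and> length Us = n"
  have bound: "n \<le> card H" if "?P n" for n
    using that independent_over_fixed_field_length_le[OF H K] by auto
  have "?P (GREATEST n. ?P n)"
    using bound by (intro GreatestI_nat[of ?P 0 "card H"]) auto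
  then obtain Us where Us: "independent ?F Us" "length Us = (GREATEST n. ?P n)"
    by blast
  have F: "subfield ?F R"
    using subfield_fixed_field subgroup_FieldAutoGroupD(1)[OF H(1) K] by blast
  have "x \<in> Span ?F Us" if x: "x \<in> carrier R" for x
  proof (rule ccontr)
    assume "x \<notin> Span ?F Us"
    \<comment> \<open>An element outside the span would lengthen the list beyond the
      maximum.\<close>
    then have "independent ?F (x # Us)"
      using x Us(1) by (intro li_Cons)
    then have "?P (Suc (length Us))"
      by (metis length_Cons)
    then have "Suc (length Us) \<le> (GREATEST n. ?P n)"
      using bound by (intro Greatest_le_nat[of ?P _ "card H"]) auto
    with Us(2) show False by simp
  qed
  moreover have "Span ?F Us \<subseteq> carrier R"
    using Span_in_carrier[OF subfieldE(3)[OF F] independent_in_carrier[OF Us(1)]] .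
  ultimately show thesis
    using that[of Us] Us(1) bound by blast
qed

section \<open>The Galois correspondence\<close>

theorem theorem3p16:
  fixes L :: "('a, 'b) ring_scheme" and K :: "'a set"
  assumes "field L" and "subfield K L"
    and "ring.finite_transcendence_degree L K"
    and "complete_galois_over L K"
  defines "subgroups \<equiv> {H. subgroup H (FieldAutoGroup L K) \<and> finite H}"
    and "subfields \<equiv> {M. intermediate_field L K M \<and> ring.finite_dimension L M (carrier L)}"
  shows "bij_betw (fixed_field L) subgroups subfields \<and>
    bij_betw (field_auto L) subfields subgroups \<and>
    (\<forall>H\<in>subgroups. field_auto L (fixed_field L H) = H) \<and>
    (\<forall>M\<in>subfields. fixed_field L (field_auto L M) = M)"
proof -
  interpret field L by fact
  have K: "K \<subseteq> carrier L"
    using subfieldE(3)[OF assms(2)] .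
  have to_subfields: "fixed_field L H \<in> subfields \<and> field_auto L (fixed_field L H) = H"
    if "H \<in> subgroups" for H
  proof -
    have H: "subgroup H (FieldAutoGroup L K)" "finite H"
      using that by (auto simp: subgroups_def)
    note sub = subgroup_FieldAutoGroupD(1)[OF H(1) K]
    have F: "subfield (fixed_field L H) L"
      by (rule subfield_fixed_field[OF sub])
    have "K \<subseteq> fixed_field L H"
      using sub K field_autoD(4) by (fastforce simp: fixed_field_def)
    moreover obtain Us where Us: "independent (fixed_field L H) Us" "length Us \<le> card H"
      "Span (fixed_field L H) Us = carrier L"
      using exists_basis_over_fixed_field[OF H K] .
    ultimately have mem: "fixed_field L H \<in> subfields"
      using F dimensionI[OF F Us(1,3)]
      by (auto simp: subfields_def intermediate_field_def finite_dimension_def)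
    have "H \<subseteq> field_auto L (fixed_field L H)"
      using sub by (auto simp: field_auto_def fixed_field_def)
    \<comment> \<open>The basis has at most \<open>card H\<close> elements, so the automorphism
      group is no larger than its subset \<open>H\<close> and must equal it.\<close>
    moreover have "finite (field_auto L (fixed_field L H))"
      "card (field_auto L (fixed_field L H)) \<le> card H"
      using card_field_auto_le_length_spanning[OF F independent_in_carrier[OF Us(1)] Us(3)] Us(2)
      by auto
    ultimately show ?thesis
      using mem card_seteq by blast
  qed
  have to_subgroups: "field_auto L M \<in> subgroups \<and> fixed_field L (field_auto L M) = M"
    if "M \<in> subfields" for M
  proof -
    have M: "subfield M L" "K \<subseteq> M" "intermediate_field L K M" "finite_dimension M (carrier L)"
      using that by (auto simp: subfields_def intermediate_field_def)
    \<comment> \<open>Both sets are subgroups of the group of bijections, and fixing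
      \<open>M\<close> entails fixing the smaller field \<open>K\<close>.\<close>
    have "subgroup (field_auto L M) (FieldAutoGroup L K)"
      unfolding FieldAutoGroup_def
      using M(2) subgroup_field_auto[OF K] subgroup_field_auto[OF subfieldE(3)[OF M(1)]]
      by (intro group.subgroup_incl[OF group_BijGroup]) (auto simp: field_auto_def)
    moreover obtain n where "dimension n M (carrier L)"
      using M(4) by (auto simp: finite_dimension_def)
    then obtain Us where "set Us \<subseteq> carrier L" "Span M Us = carrier L"
      using exists_base[OF M(1)] by blast
    then have "finite (field_auto L M)"
      using card_field_auto_le_length_spanning[OF M(1)] by blast
    \<comment> \<open>This return trip is the complete Galois hypothesis applied to the intermediate
      field \<open>M\<close>.\<close>
    moreover have "fixed_field L (field_auto L M) = M"
      using assms(4) M(3) by (simp add: complete_galois_over_def galois_over_def)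
    ultimately show ?thesis
      by (simp add: subgroups_def)
  qed
  have "bij_betw (fixed_field L) subgroups subfields"
    using to_subfields to_subgroups by (intro bij_betw_byWitness[where f' = "field_auto L"]) blast+
  moreover have "bij_betw (field_auto L) subfields subgroups"
    using to_subfields to_subgroups by (intro bij_betw_byWitness[where f' = "fixed_field L"]) blast+
  ultimately show ?thesis
    using to_subfields to_subgroups by blast
qed

end
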